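(* Let $G$ be a metrizable strongly topological gyrogroup which is isomorphic (as a topological gyrogroup) to a subgyrogroup of a separable Hausdorff strongly topological gyrogroup. Then $G$ is separable.
   Context: All topological spaces are assumed to be Hausdorff. A gyrogroup is a set $G$ with a binary operation $\oplus$ such that: (G1) there is a unique $0\in G$ with $0\oplus a=a=a\oplus 0$ for all $a\in G$; (G2) each $x\in G$ has a unique inverse $\ominus x\in G$ with $\ominus x\oplus x=0=x\oplus(\ominus x)$; (G3) for all $x,y\in G$ there is $\mathrm{gyr}[x,y]\in\mathrm{Aut}(G,\oplus)$ (a bijection of $G$ preserving $\oplus$) with $x\oplus(y\oplus z)=(x\oplus y)\oplus\mathrm{gyr}[x,y](z)$ for all $z\in G$; (G4) $\mathrm{gyr}[x\oplus y,y]=\mathrm{gyr}[x,y]$ for all $x,y\in G$. A topological gyrogroup is a gyrogroup $G$ with a topology such that $\oplus:G\times G\to G$ is jointly continuous and $x\mapsto\ominus x$ is continuous. A strongly topological gyrogroup is a topological gyrogroup having a neighborhood base $\mathscr U$ of $0$ such that $\mathrm{gyr}[x,y](U)=U$ for all $U\in\mathscr U$ and all $x,y\in G$. A subgyrogroup of a gyrogroup $X$ is a nonempty $H\subset X$ that is a gyrogroup under the inherited operation and such that the restriction of $\mathrm{gyr}[a,b]$ to $H$ is an automorphism of $H$ for all $a,b\in H$; it carries the subspace topology. An isomorphism of topological gyrogroups is a bijection preserving $\oplus$ that is a homeomorphism. Separable means having a countable dense subset. *)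

theory Defs
  imports "HOL-Analysis.Analysis"
begin

definition gyro_zero :: "'a set \<Rightarrow> ('a \<Rightarrow> 'a \<Rightarrow> 'a) \<Rightarrow> 'a" where
  "gyro_zero G f = (THE e. e \<in> G \<and> (\<forall>a\<in>G. f e a = a \<and> f a e = a))"

definition gyro_inverse :: "'a set \<Rightarrow> ('a \<Rightarrow> 'a \<Rightarrow> 'a) \<Rightarrow> 'a \<Rightarrow> 'a" where
  "gyro_inverse G f x = (THE y. y \<in> G \<and> f y x = gyro_zero G f \<and> f x y = gyro_zero G f)"

definition magma_automorphism :: "'a set \<Rightarrow> ('a \<Rightarrow> 'a \<Rightarrow> 'a) \<Rightarrow> ('a \<Rightarrow> 'a) \<Rightarrow> bool" where
  "magma_automorphism G f \<phi> \<longleftrightarrow>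
     bij_betw \<phi> G G \<and> (\<forall>a\<in>G. \<forall>b\<in>G. \<phi> (f a b) = f (\<phi> a) (\<phi> b))"

text \<open>
  The gyrations are a parameter; by \<open>gyr_unique\<close> below they are determined on the carrier
  by the operation, so this parameter carries no additional structure.
\<close>

locale gyrogroup =
  fixes G :: "'a set"
    and gadd :: "'a \<Rightarrow> 'a \<Rightarrow> 'a"  (infixl \<open>\<oplus>\<close> 65)
    and gyr :: "'a \<Rightarrow> 'a \<Rightarrow> 'a \<Rightarrow> 'a"
  assumes closed: "\<lbrakk>x \<in> G; y \<in> G\<rbrakk> \<Longrightarrow> x \<oplus> y \<in> G"
    and ex1_zero: "\<exists>!e. e \<in> G \<and> (\<forall>a\<in>G. e \<oplus> a = a \<and> a \<oplus> e = a)"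
    and ex1_inverse: "x \<in> G \<Longrightarrow>
          \<exists>!y. y \<in> G \<and> y \<oplus> x = gyro_zero G (\<oplus>) \<and> x \<oplus> y = gyro_zero G (\<oplus>)"
    and gyr_automorphism: "\<lbrakk>x \<in> G; y \<in> G\<rbrakk> \<Longrightarrow> magma_automorphism G (\<oplus>) (gyr x y)"
    and gyroassoc: "\<lbrakk>x \<in> G; y \<in> G; z \<in> G\<rbrakk> \<Longrightarrow> x \<oplus> (y \<oplus> z) = (x \<oplus> y) \<oplus> gyr x y z"
    and gyr_loop: "\<lbrakk>x \<in> G; y \<in> G; z \<in> G\<rbrakk> \<Longrightarrow> gyr (x \<oplus> y) y z = gyr x y z"

lemma (in gyrogroup) left_cancel:
  assumes "a \<in> G" "b \<in> G" "c \<in> G" "a \<oplus> b = a \<oplus> c"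
  shows "b = c"
proof -
  have zero: "gyro_zero G (\<oplus>) \<oplus> x = x" if "x \<in> G" for x
    using theI'[OF ex1_zero] that unfolding gyro_zero_def by blast
  obtain a' where a': "a' \<in> G" "a' \<oplus> a = gyro_zero G (\<oplus>)"
    using ex1_inverse[OF assms(1)] by blast
  have bij: "bij_betw (gyr a' a) G G"
    using gyr_automorphism[OF a'(1) assms(1)] by (simp add: magma_automorphism_def)
  have "a' \<oplus> (a \<oplus> x) = gyr a' a x" if "x \<in> G" for x
    using gyroassoc[OF a'(1) assms(1) that] a'(2) zero bij_betwE[OF bij] that by simp
  then have "gyr a' a b = gyr a' a c"
    using assms by metis
  then show ?thesis
    using bij assms(2,3) by (auto simp: bij_betw_def inj_on_def)
qed

lemma gyr_unique:
  assumes g: "gyrogroup G f gyr" and g': "gyrogroup G f gyr'" and "x \<in> G" "y \<in> G" "z \<in> G"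
  shows "gyr x y z = gyr' x y z"
proof -
  have "f (f x y) (gyr x y z) = f (f x y) (gyr' x y z)"
    using assms by (metis gyrogroup.gyroassoc)
  moreover have "gyr x y z \<in> G" "gyr' x y z \<in> G"
    using gyrogroup.gyr_automorphism[OF g] gyrogroup.gyr_automorphism[OF g'] assms(3-5)
    unfolding magma_automorphism_def by (metis bij_betwE)+
  ultimately show ?thesis
    using gyrogroup.left_cancel[OF g] gyrogroup.closed[OF g] assms by blast
qed

text \<open>
  The gyrogroup structure of \<open>H\<close> is not assumed to use the gyrations of the ambient gyrogroup;
  that these restrict to automorphisms of \<open>H\<close> is a separate requirement.
\<close>

definition subgyrogroup ::
  "'a set \<Rightarrow> 'a set \<Rightarrow> ('a \<Rightarrow> 'a \<Rightarrow> 'a) \<Rightarrow> ('a \<Rightarrow> 'a \<Rightarrow> 'a \<Rightarrow> 'a) \<Rightarrow> bool" where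
  "subgyrogroup H X f gyr \<longleftrightarrow>
     H \<noteq> {} \<and> H \<subseteq> X \<and> (\<exists>gyr'. gyrogroup H f gyr') \<and>
     (\<forall>a\<in>H. \<forall>b\<in>H. magma_automorphism H f (gyr a b))"

locale topological_gyrogroup = gyrogroup "topspace T" gadd gyr
  for T :: "'a topology"
    and gadd :: "'a \<Rightarrow> 'a \<Rightarrow> 'a"  (infixl \<open>\<oplus>\<close> 65)
    and gyr :: "'a \<Rightarrow> 'a \<Rightarrow> 'a \<Rightarrow> 'a" +
  assumes continuous_gadd: "continuous_map (prod_topology T T) T (\<lambda>(x, y). x \<oplus> y)"
    and continuous_inverse: "continuous_map T T (gyro_inverse (topspace T) (\<oplus>))"

text \<open>
  Members of a neighbourhood base need not be open. The library's \<open>neighbourhood_base_at\<close> does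
  not require every set satisfying the predicate to be a neighbourhood, hence the first conjunct.
\<close>

definition neighbourhood_base_family :: "'a topology \<Rightarrow> 'a \<Rightarrow> 'a set set \<Rightarrow> bool" where
  "neighbourhood_base_family T x \<U> \<longleftrightarrow>
     (\<forall>U\<in>\<U>. U \<subseteq> topspace T \<and> (\<exists>V. openin T V \<and> x \<in> V \<and> V \<subseteq> U)) \<and>
     neighbourhood_base_at x (\<lambda>U. U \<in> \<U>) T"

locale strongly_topological_gyrogroup = topological_gyrogroup T gadd gyr
  for T :: "'a topology"
    and gadd :: "'a \<Rightarrow> 'a \<Rightarrow> 'a"  (infixl \<open>\<oplus>\<close> 65)
    and gyr :: "'a \<Rightarrow> 'a \<Rightarrow> 'a \<Rightarrow> 'a" +
  assumes invariant_base: "\<exists>\<U>. neighbourhood_base_family T (gyro_zero (topspace T) (\<oplus>)) \<U> \<and>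
          (\<forall>U\<in>\<U>. \<forall>x\<in>topspace T. \<forall>y\<in>topspace T. gyr x y ` U = U)"

definition topological_gyrogroup_isomorphism ::
  "'a topology \<Rightarrow> ('a \<Rightarrow> 'a \<Rightarrow> 'a) \<Rightarrow> 'b topology \<Rightarrow> ('b \<Rightarrow> 'b \<Rightarrow> 'b) \<Rightarrow> ('a \<Rightarrow> 'b) \<Rightarrow> bool" where
  "topological_gyrogroup_isomorphism S f T g \<phi> \<longleftrightarrow>
     homeomorphic_map S T \<phi> \<and>
     (\<forall>x\<in>topspace S. \<forall>y\<in>topspace S. \<phi> (f x y) = g (\<phi> x) (\<phi> y))"

end

theory Submission
  imports Defs
begin

text \<open>
  A countable dense set \<open>D\<close> makes every subset \<open>H\<close> of the ambient gyrogroup \<open>\<omega>\<close>-narrow: for a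
  neighbourhood \<open>U\<close> of \<open>0\<close> and each \<open>d \<in> D\<close> choose, if possible, one \<open>c \<in> H\<close> with
  \<open>d \<in> c \<oplus> W\<close>, where \<open>W\<close> is small. Any \<open>h \<in> H\<close> has some \<open>d \<in> h \<oplus> W\<close>, and passing from
  \<open>c\<close> to \<open>d\<close> to \<open>h\<close> costs only gyrations, which the gyration-invariant neighbourhoods absorb,
  so \<open>h \<in> c \<oplus> U\<close>. If \<open>H\<close> is a first countable subgyrogroup, the union of these countable
  sets over a countable base at \<open>0\<close> is dense in \<open>H\<close>.
\<close>

section \<open>Cancellation laws in gyrogroups and subgyrogroups\<close>

context gyrogroup
begin

abbreviation gzero :: "'a"  (\<open>\<zero>\<close>)
  where "\<zero> \<equiv> gyro_zero G (\<oplus>)"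

abbreviation ginv :: "'a \<Rightarrow> 'a"  (\<open>\<ominus>_\<close> [81] 80)
  where "\<ominus> x \<equiv> gyro_inverse G (\<oplus>) x"

lemma zero_closed [simp]: "\<zero> \<in> G"
  and zero_left [simp]: "a \<in> G \<Longrightarrow> \<zero> \<oplus> a = a"
  and zero_right [simp]: "a \<in> G \<Longrightarrow> a \<oplus> \<zero> = a"
  using theI'[OF ex1_zero] unfolding gyro_zero_def by blast+

lemma
  assumes "x \<in> G"
  shows inverse_closed [simp]: "\<ominus>x \<in> G"
    and inverse_left [simp]: "\<ominus>x \<oplus> x = \<zero>"
    and inverse_right [simp]: "x \<oplus> \<ominus>x = \<zero>"
  using theI'[OF ex1_inverse[OF assms]] unfolding gyro_inverse_def by blast+

lemma inverse_zero [simp]: "\<ominus>\<zero> = \<zero>"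
  using zero_left[of "\<ominus>\<zero>"] inverse_right[of "\<zero>"] by simp

lemma gyr_bij: "\<lbrakk>x \<in> G; y \<in> G\<rbrakk> \<Longrightarrow> bij_betw (gyr x y) G G"
  using gyr_automorphism by (simp add: magma_automorphism_def)

lemma gyr_closed [simp]: "\<lbrakk>x \<in> G; y \<in> G; z \<in> G\<rbrakk> \<Longrightarrow> gyr x y z \<in> G"
  using gyr_bij bij_betwE by blast

lemma gyr_zero_left [simp]:
  assumes "a \<in> G" "z \<in> G"
  shows "gyr \<zero> a z = z"
proof -
  have "a \<oplus> z = a \<oplus> gyr \<zero> a z"
    using gyroassoc[of "\<zero>" a z] assms by (simp add: closed)
  then show ?thesis
    using left_cancel[of a z "gyr \<zero> a z"] assms by simp
qed

text \<open>The loop property gives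
  \<open>gyr (\<ominus>a \<oplus> a) a = gyr (\<ominus>a) a\<close>, and the left side is
  \<open>gyr \<zero> a\<close>, the identity. So gyroassociativity is plain associativity
  here.\<close>

lemma inverse_add_cancel:
  assumes "a \<in> G" "z \<in> G"
  shows "\<ominus>a \<oplus> (a \<oplus> z) = z"
  using gyroassoc[of "\<ominus>a" a z] gyr_loop[of "\<ominus>a" a z] assms by simp

lemma add_inverse_cancel:
  assumes "a \<in> G" "z \<in> G"
  shows "a \<oplus> (\<ominus>a \<oplus> z) = z"
  using gyroassoc[of a "\<ominus>a" z] gyr_loop[of a "\<ominus>a" z] assms by simp

text \<open>Right addition of \<open>b\<close> is undone by a gyrated copy of
  \<open>\<ominus>b\<close>, by gyroassociativity with third argument \<open>\<ominus>b\<close>.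
  Gyration-invariant neighbourhoods are what absorbs this twist later.\<close>

lemma add_gyr_inverse_cancel:
  assumes "a \<in> G" "b \<in> G"
  shows "(a \<oplus> b) \<oplus> gyr a b (\<ominus>b) = a"
  using gyroassoc[of a b "\<ominus>b"] assms by simp

text \<open>The zero and the inverses that \<open>H\<close> has as a gyrogroup of its own agree with
  the ambient ones, by left cancellation in \<open>G\<close>.\<close>

lemma subgyrogroup_closed:
  assumes "subgyrogroup H G (\<oplus>) gyr"
  shows "H \<subseteq> G" "\<zero> \<in> H" "\<And>x y. \<lbrakk>x \<in> H; y \<in> H\<rbrakk> \<Longrightarrow> x \<oplus> y \<in> H"
    "\<And>x. x \<in> H \<Longrightarrow> \<ominus>x \<in> H"
proof -
  obtain gyr' where g: "gyrogroup H (\<oplus>) gyr'"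
    using assms unfolding subgyrogroup_def by blast
  interpret H: gyrogroup H "(\<oplus>)" gyr' by (fact g)
  show sub: "H \<subseteq> G"
    using assms unfolding subgyrogroup_def by blast
  have HG: "H.gzero \<in> G"
    using sub H.zero_closed by (rule subsetD)
  have "H.gzero \<oplus> H.gzero = H.gzero \<oplus> \<zero>"
    unfolding H.zero_left[OF H.zero_closed] zero_right[OF HG] ..
  then have zero_eq: "H.gzero = \<zero>"
    by (rule left_cancel[OF HG HG zero_closed])
  then show "\<zero> \<in> H"
    using H.zero_closed by simp
  show "x \<oplus> y \<in> H" if "x \<in> H" "y \<in> H" for x y
    using that by (rule H.closed)
  show "\<ominus>x \<in> H" if x: "x \<in> H" for x
  proof -
    have "x \<oplus> \<ominus>x = x \<oplus> H.ginv x"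
      unfolding inverse_right[OF subsetD[OF sub x]] H.inverse_right[OF x] zero_eq ..
    then have "\<ominus>x = H.ginv x"
      using left_cancel inverse_closed x sub H.inverse_closed[OF x] by blast
    then show ?thesis
      using H.inverse_closed[OF x] by simp
  qed
qed

end

section \<open>Neighbourhoods of zero under translation, inversion and addition\<close>

context topological_gyrogroup
begin

notation gzero (\<open>\<zero>\<close>)
notation ginv (\<open>\<ominus>_\<close> [81] 80)

lemma continuous_left_translation:
  assumes "a \<in> topspace T"
  shows "continuous_map T T ((\<oplus>) a)"
proof -
  have "continuous_map T (prod_topology T T) (\<lambda>x. (a, x))"
    using assms by (simp add: continuous_map_pairwise o_def)
  from continuous_map_compose[OF this continuous_gadd] show ?thesis
    by (simp add: o_def)
qed

lemma openin_left_translation_preimage: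
  "\<lbrakk>a \<in> topspace T; openin T U\<rbrakk> \<Longrightarrow> openin T {x \<in> topspace T. a \<oplus> x \<in> U}"
  using continuous_left_translation openin_continuous_map_preimage by blast

lemma openin_inverse_preimage:
  "openin T U \<Longrightarrow> openin T {x \<in> topspace T. \<ominus>x \<in> U}"
  using continuous_inverse openin_continuous_map_preimage by blast

lemma zero_neighbourhood_add:
  assumes "openin T U" "\<zero> \<in> U"
  obtains N where "openin T N" "\<zero> \<in> N" "\<And>x y. \<lbrakk>x \<in> N; y \<in> N\<rbrakk> \<Longrightarrow> x \<oplus> y \<in> U"
proof -
  define P where "P = {p \<in> topspace (prod_topology T T). (\<lambda>(x, y). x \<oplus> y) p \<in> U}"
  have "openin (prod_topology T T) P"
    unfolding P_def using continuous_gadd assms(1) by (rule openin_continuous_map_preimage)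
  moreover have "(\<zero>, \<zero>) \<in> P"
    using assms(2) by (simp add: P_def)
  ultimately obtain A B where AB: "openin T A" "openin T B" "\<zero> \<in> A" "\<zero> \<in> B" "A \<times> B \<subseteq> P"
    unfolding openin_prod_topology_alt by metis
  show thesis
  proof
    show "openin T (A \<inter> B)" "\<zero> \<in> A \<inter> B"
      using AB by auto
    show "x \<oplus> y \<in> U" if "x \<in> A \<inter> B" "y \<in> A \<inter> B" for x y
    proof -
      have "(x, y) \<in> P" using that AB(5) by blast
      then show ?thesis by (simp add: P_def)
    qed
  qed
qed

end

section \<open>Narrowness and separability of subgyrogroups\<close>

context strongly_topological_gyrogroup
begin

text \<open>Members of the invariant base need not be open, so the invariant set \<open>V\<close>
  comes with an open \<open>N\<close> inside it.\<close>

lemma gyr_invariant_neighbourhood: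
  assumes "openin T W" "\<zero> \<in> W"
  obtains N V where "openin T N" "\<zero> \<in> N" "N \<subseteq> V" "V \<subseteq> W"
    "\<And>x y. \<lbrakk>x \<in> topspace T; y \<in> topspace T\<rbrakk> \<Longrightarrow> gyr x y ` V = V"
proof -
  obtain \<U> where "neighbourhood_base_family T \<zero> \<U>"
    and inv: "\<And>U x y. \<lbrakk>U \<in> \<U>; x \<in> topspace T; y \<in> topspace T\<rbrakk> \<Longrightarrow> gyr x y ` U = U"
    using invariant_base by metis
  then obtain N V where "openin T N" "V \<in> \<U>" "\<zero> \<in> N" "N \<subseteq> V" "V \<subseteq> W"
    using assms unfolding neighbourhood_base_family_def neighbourhood_base_at_def by metis
  then show thesis
    by (intro that[of N V]) (simp_all add: inv)
qed

lemma separable_imp_narrow: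
  assumes "separable_space T" "H \<subseteq> topspace T" "openin T U" "\<zero> \<in> U"
  obtains C where "countable C" "C \<subseteq> H" "\<And>h. h \<in> H \<Longrightarrow> \<exists>c\<in>C. \<ominus>c \<oplus> h \<in> U"
proof -
  obtain D where D: "countable D" "D \<subseteq> topspace T" "T closure_of D = topspace T"
    using assms(1) unfolding separable_space_def by blast
  obtain A where A: "openin T A" "\<zero> \<in> A" "\<And>x y. \<lbrakk>x \<in> A; y \<in> A\<rbrakk> \<Longrightarrow> x \<oplus> y \<in> U"
    using zero_neighbourhood_add[OF assms(3,4)] by blast
  obtain N V where N: "openin T N" "\<zero> \<in> N" "N \<subseteq> V" "V \<subseteq> A"
    and V: "\<And>x y. \<lbrakk>x \<in> topspace T; y \<in> topspace T\<rbrakk> \<Longrightarrow> gyr x y ` V = V"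
    using gyr_invariant_neighbourhood[OF A(1,2)] by blast
  \<comment> \<open>Both \<open>w\<close> and \<open>\<ominus>w\<close> lie in \<open>N\<close> for
    \<open>w\<close> in \<open>W\<close>: the element joining \<open>c\<close> to \<open>d\<close>
    is used directly, the one joining \<open>h\<close> to \<open>d\<close> through its
    inverse.\<close>
  define W where "W = N \<inter> {x \<in> topspace T. \<ominus>x \<in> N}"
  have W: "openin T W" "\<zero> \<in> W"
    using N openin_inverse_preimage by (auto simp: W_def)
  have V_sub: "V \<subseteq> topspace T"
    using N(4) openin_subset[OF A(1)] by blast
  define Q where "Q d = {c \<in> H. \<ominus>c \<oplus> d \<in> W}" for d
  define C where "C = (\<lambda>d. SOME c. c \<in> Q d) ` {d \<in> D. Q d \<noteq> {}}"
  have chosen: "(SOME c. c \<in> Q d) \<in> Q d" if "Q d \<noteq> {}" for d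
    using that some_in_eq by blast
  show thesis
  proof
    show "countable C"
      using D(1) by (auto simp: C_def)
    show "C \<subseteq> H"
      using chosen by (auto simp: C_def Q_def)
    fix h assume h: "h \<in> H"
    then have hT: "h \<in> topspace T" using assms(2) by blast
    \<comment> \<open>This plays the role of \<open>h \<oplus> W\<close>: an open set containing
      \<open>h\<close>, since \<open>\<ominus>h \<oplus> h = \<zero>\<close>, and hence meeting
      \<open>D\<close>.\<close>
    let ?S = "{x \<in> topspace T. \<ominus>h \<oplus> x \<in> W}"
    have "openin T ?S"
      using hT W(1) by (intro openin_left_translation_preimage) auto
    moreover have "h \<in> ?S" using hT W by simp
    ultimately obtain d where d: "d \<in> D" "\<ominus>h \<oplus> d \<in> W"
      using D(3) unfolding dense_intersects_open by blast
    then have dT: "d \<in> topspace T" using D(2) by blast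
    have "Q d \<noteq> {}" using d h by (auto simp: Q_def)
    then obtain c where c: "c \<in> C" "c \<in> H" "\<ominus>c \<oplus> d \<in> W"
      using d(1) chosen by (fastforce simp: C_def Q_def)
    then have cT: "c \<in> topspace T" using assms(2) by blast
    define w where "w = \<ominus>h \<oplus> d"
    define v where "v = \<ominus>c \<oplus> d"
    have wT: "w \<in> topspace T" and vT: "v \<in> topspace T"
      using hT dT cT by (simp_all add: w_def v_def closed)
    have hw: "h \<oplus> w = d" and cv: "c \<oplus> v = d"
      using hT cT dT by (simp_all add: w_def v_def add_inverse_cancel)
    have "gyr h w (\<ominus>w) \<in> gyr h w ` V"
      using d(2) N(3) by (auto simp: w_def W_def)
    then have "gyr h w (\<ominus>w) \<in> V" using V[OF hT wT] by simp
    then have "gyr h w (\<ominus>w) \<in> gyr c v ` V" using V[OF cT vT] by simp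
    \<comment> \<open>Invariance of \<open>V\<close> rewrites the correction leading from
      \<open>d\<close> back to \<open>h\<close> as a \<open>gyr c v\<close> image. Gyroassociativity
      can then regroup \<open>(c \<oplus> v) \<oplus> gyr c v u\<close> as
      \<open>c \<oplus> (v \<oplus> u)\<close>.\<close>
    then obtain u where u: "u \<in> V" "gyr h w (\<ominus>w) = gyr c v u" by blast
    have uT: "u \<in> topspace T" using u(1) V_sub by blast
    have "h = (h \<oplus> w) \<oplus> gyr h w (\<ominus>w)"
      using hT wT by (simp add: add_gyr_inverse_cancel)
    also have "\<dots> = (c \<oplus> v) \<oplus> gyr c v u"
      by (simp add: hw cv u(2))
    also have "\<dots> = c \<oplus> (v \<oplus> u)"
      using gyroassoc[OF cT vT uT] by simp
    finally have "\<ominus>c \<oplus> h = v \<oplus> u"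
      using cT vT uT by (simp add: inverse_add_cancel closed)
    moreover have "v \<in> A" "u \<in> A"
      using c(3) N(3,4) u(1) by (auto simp: v_def W_def)
    ultimately show "\<exists>c\<in>C. \<ominus>c \<oplus> h \<in> U"
      using c(1) A(3)[of v u] by metis
  qed
qed

lemma separable_space_first_countable_subgyrogroup:
  assumes "separable_space T" "subgyrogroup H (topspace T) (\<oplus>) gyr"
    and "first_countable (subtopology T H)"
  shows "separable_space (subtopology T H)"
proof -
  note H = subgyrogroup_closed[OF assms(2)]
  have top_H: "topspace (subtopology T H) = H"
    using H(1) by auto
  obtain \<B> where \<B>: "countable \<B>" "\<And>B. B \<in> \<B> \<Longrightarrow> openin (subtopology T H) B"
    and base: "\<And>U. \<lbrakk>openin (subtopology T H) U; \<zero> \<in> U\<rbrakk> \<Longrightarrow> \<exists>B\<in>\<B>. \<zero> \<in> B \<and> B \<subseteq> U"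
    using assms(3)[unfolded first_countable_def top_H, rule_format, OF H(2)] by metis
  \<comment> \<open>First countability allows sets in \<open>\<B>\<close> that miss
    \<open>\<zero>\<close>, hence the guard. Otherwise \<open>B\<close> is the trace on
    \<open>H\<close> of an open \<open>U\<close>, and \<open>\<ominus>c \<oplus> h\<close> stays in
    \<open>H\<close>.\<close>
  have "\<exists>C. countable C \<and> C \<subseteq> H \<and> (\<zero> \<in> B \<longrightarrow> (\<forall>h\<in>H. \<exists>c\<in>C. \<ominus>c \<oplus> h \<in> B))" if "B \<in> \<B>" for B
  proof (cases "\<zero> \<in> B")
    case True
    obtain U where U: "openin T U" "B = U \<inter> H"
      using \<B>(2)[OF \<open>B \<in> \<B>\<close>] unfolding openin_subtopology by blast
    then have "\<zero> \<in> U" using True by blast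
    obtain C where C: "countable C" "C \<subseteq> H" "\<And>h. h \<in> H \<Longrightarrow> \<exists>c\<in>C. \<ominus>c \<oplus> h \<in> U"
      using separable_imp_narrow[OF assms(1) H(1) U(1) \<open>\<zero> \<in> U\<close>] by blast
    have "\<exists>c\<in>C. \<ominus>c \<oplus> h \<in> B" if "h \<in> H" for h
      using C(3)[OF that] C(2) that H(3,4) U(2) by blast
    then show ?thesis using C by blast
  qed blast
  then obtain C where C: "\<And>B. B \<in> \<B> \<Longrightarrow> countable (C B) \<and> C B \<subseteq> H"
    and narrow: "\<And>B h. \<lbrakk>B \<in> \<B>; \<zero> \<in> B; h \<in> H\<rbrakk> \<Longrightarrow> \<exists>c\<in>C B. \<ominus>c \<oplus> h \<in> B"
    by metis
  define E where "E = (\<Union>B\<in>\<B>. C B)"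
  have E: "countable E" "E \<subseteq> H"
    using C \<B>(1) by (auto simp: E_def)
  have "E \<inter> S \<noteq> {}" if S: "openin (subtopology T H) S" "S \<noteq> {}" for S
  proof -
    obtain U where U: "openin T U" "S = U \<inter> H"
      using S(1) unfolding openin_subtopology by blast
    obtain h where h: "h \<in> U" "h \<in> H" using S(2) U(2) by blast
    then have hT: "h \<in> topspace T" using H(1) by blast
    have "openin T {x \<in> topspace T. h \<oplus> x \<in> U}"
      using hT U(1) by (rule openin_left_translation_preimage)
    moreover have "\<zero> \<in> {x \<in> topspace T. h \<oplus> x \<in> U}" using h hT by simp
    ultimately obtain N V where N: "openin T N" "\<zero> \<in> N" "N \<subseteq> V"
      and VU: "V \<subseteq> {x \<in> topspace T. h \<oplus> x \<in> U}"
      and V: "\<And>x y. \<lbrakk>x \<in> topspace T; y \<in> topspace T\<rbrakk> \<Longrightarrow> gyr x y ` V = V"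
      using gyr_invariant_neighbourhood by blast
    \<comment> \<open>Narrowness controls \<open>\<ominus>c \<oplus> h\<close>, whereas
      \<open>c\<close> has to be near \<open>h\<close>. The roles are exchanged by an inversion, so
      \<open>B\<close> is chosen with its inverses in \<open>N\<close>.\<close>
    have "openin (subtopology T H) ({x \<in> topspace T. \<ominus>x \<in> N} \<inter> H)"
      using openin_inverse_preimage[OF N(1)] unfolding openin_subtopology by blast
    moreover have "\<zero> \<in> {x \<in> topspace T. \<ominus>x \<in> N} \<inter> H" using N(2) H(2) by simp
    ultimately obtain B where B: "B \<in> \<B>" "\<zero> \<in> B" "B \<subseteq> {x \<in> topspace T. \<ominus>x \<in> N} \<inter> H"
      using base by blast
    obtain c where c: "c \<in> C B" "\<ominus>c \<oplus> h \<in> B"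
      using narrow[OF B(1,2) h(2)] by blast
    have cH: "c \<in> H" using C[OF B(1)] c(1) by blast
    then have cT: "c \<in> topspace T" using H(1) by blast
    define u where "u = \<ominus>c \<oplus> h"
    have uT: "u \<in> topspace T" and "\<ominus>u \<in> V"
      using c(2) B(3) N(3) by (auto simp: u_def)
    \<comment> \<open>Since \<open>c \<oplus> u = h\<close>, right cancellation exhibits
      \<open>c\<close> as \<open>h\<close> plus a gyration of \<open>\<ominus>u\<close>. That
      gyration stays in \<open>V\<close>, so \<open>c\<close> falls into \<open>U\<close>.\<close>
    then have "gyr c u (\<ominus>u) \<in> V" using V[OF cT uT] by blast
    moreover have "h \<oplus> gyr c u (\<ominus>u) = c"
      using add_gyr_inverse_cancel[OF cT uT] hT cT by (simp add: u_def add_inverse_cancel)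
    ultimately have "c \<in> U" using VU by auto
    then have "c \<in> E \<inter> S" using c(1) B(1) cH U(2) by (auto simp: E_def)
    then show ?thesis by blast
  qed
  then have "subtopology T H closure_of E = topspace (subtopology T H)"
    unfolding dense_intersects_open by blast
  then show ?thesis
    using E unfolding separable_space_def top_H by blast
qed

end

theorem corollary4p10:
  fixes G :: "'a topology" and addG :: "'a \<Rightarrow> 'a \<Rightarrow> 'a" and gyrG :: "'a \<Rightarrow> 'a \<Rightarrow> 'a \<Rightarrow> 'a"
    and X :: "'b topology" and addX :: "'b \<Rightarrow> 'b \<Rightarrow> 'b" and gyrX :: "'b \<Rightarrow> 'b \<Rightarrow> 'b \<Rightarrow> 'b"
    and H :: "'b set"
  assumes "strongly_topological_gyrogroup G addG gyrG"
    and "metrizable_space G"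
    and "strongly_topological_gyrogroup X addX gyrX"
    and "Hausdorff_space X"
    and "separable_space X"
    and "subgyrogroup H (topspace X) addX gyrX"
    and "\<exists>\<phi>. topological_gyrogroup_isomorphism G addG (subtopology X H) addX \<phi>"
  shows "separable_space G"
proof -
  have homeo: "G homeomorphic_space subtopology X H"
    using assms(7) homeomorphic_map_imp_homeomorphic_space
    unfolding topological_gyrogroup_isomorphism_def by blast
  \<comment> \<open>Metrizability enters through first countability, which the homeomorphism carries
    from \<open>G\<close> to \<open>H\<close>; separability then travels back along it.\<close>
  then have "first_countable (subtopology X H)"
    using assms(2) metrizable_imp_first_countable homeomorphic_space_first_countability by blast
  then have "separable_space (subtopology X H)"
    by (rule strongly_topological_gyrogroup.separable_space_first_countable_subgyrogroup
        [OF assms(3,5,6)])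
  then show ?thesis
    using homeo homeomorphic_separable_space by blast
qed

end
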